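(* Let $v\in\mathbb{R}^n$ have all entries positive, let $\mathcal{M}=\mathcal{F}_v$, let $f$ be smooth, let $g(x)=\lambda\|x\|_1$ with penalty parameter $\lambda>0$, and let $F=f+g$. Suppose that the gradient of $f$ is Lipschitz continuous on $\mathcal{M}$ with Lipschitz constant $L_f$ and that $g$ is Lipschitz continuous with Lipschitz constant $L_g$ (Lipschitz continuity in the sense of the Euclidean setting). Then any accumulation point of the sequence $\{z_0,z_N,z_{2N},\dots,z_{iN},\dots\}$ generated by the accelerated manifold proximal gradient algorithm (AManPG) described in the context is a stationary point, i.e., if $z_*$ is an accumulation point of this sequence, then $0\in P_{\mathrm{T}_{z_*}\mathcal{M}}\,\partial F(z_* )$.
   Context: **Manifold.** $\mathcal{F}_v=\{x\in\mathbb{R}^{n\times q}:x^Tx=I_q,\ v\in\mathrm{span}(x)\}$ ($\mathrm{span}$ = column space) is a compact embedded submanifold of $\mathbb{R}^{n\times q}$, endowed with the Euclidean metric $\langle U,V\rangle=\mathrm{trace}(U^TV)$, $\|U\|=\|U\|_F$. For $x_\perp$ with $(x\ x_\perp)$ orthogonal, the tangent space is $\mathrm{T}_x\mathcal{M}=\{x\Omega+x_\perp K:\Omega^T=-\Omega,\ Kx^Tv=0\}$ and the normal space is its orthogonal complement, of dimension $d=q(q+1)/2+n-q$. $P_{\mathrm{T}_x\mathcal{M}}$ is the orthogonal projection onto $\mathrm{T}_x\mathcal{M}$, and $\mathrm{grad} f(x)$ is the Riemannian gradient of $f$, i.e. $P_{\mathrm{T}_x\mathcal{M}}\nabla f(x)$.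 $R$ is a retraction on $\mathcal{M}$: a smooth map from the tangent bundle to $\mathcal{M}$ (its domain need not be the entire tangent bundle) with $R_x(0_x)=x$ and $\frac{d}{dt}R_x(t\eta)|_{t=0}=\eta$, where $R_x$ is the restriction of $R$ to $\mathrm{T}_x\mathcal{M}$. $\|x\|_1$ is the sum of absolute values of the entries of $x$. $\partial F(x)=\nabla f(x)+\partial g(x)$, with $\partial g$ the convex subdifferential. **Inexact proximal step.** For $x\in\mathcal{M}$ let $V_1,\dots,V_d$ be an orthonormal basis of the normal space at $x$, and let $B_x:\mathbb{R}^d\to\mathbb{R}^{n\times q}$, $B_xu=\sum_iu_iV_i$, and $B_x^T:\mathbb{R}^{n\times q}\to\mathbb{R}^d$, $(B_x^TV)_i=\mathrm{trace}(V^TV_i)$. Let $\mathrm{Prox}_{\mu g}(z)=\arg\min_{w\in\mathbb{R}^{n\times q}}\frac12\|w-z\|^2+\mu g(w)$. For $\Lambda\in\mathbb{R}^d$ put $$w_x(\Lambda)=\mathrm{Prox}_{\mu g}\big(x-\mu(\mathrm{grad}f(x)-B_x\Lambda)\big)-x,\quad \Psi_x(\Lambda)=B_x^Tw_x(\Lambda),\quad \hat w_x(\Lambda)=P_{\mathrm{T}_x\mathcal{M}}w_x(\Lambda).$$ "Approximately solve $\eta_x\approx\arg\min_{\eta\in\mathrm{T}_x\mathcal{M}}\langle\mathrm{grad}f(x),\eta\rangle+\frac1{2\mu}\|\eta\|^2+g(x+\eta)$" means: find (by a semi-smooth Newton method applied to $\Psi_x(\Lambda)=0$) a $\Lambda\in\mathbb{R}^d$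 with $$\|\Psi_x(\Lambda)\|\le\sqrt{4\mu^2L_g^2+\|\hat w_x(\Lambda)\|^2/2}-2\mu L_g$$ and set $\eta_x=\hat w_x(\Lambda)$. **Algorithm (AManPG).** Parameters: $\mu>0$, $\sigma\in(0,1/(8\mu)]$, $\nu\in(0,1)$, a positive integer $N$, and a maximum number $N_{\max}>0$ of line search iterations. Initialize $t_0=1$, $y_0=z_0=x_0\in\mathcal{M}$. For $k=0,1,2,\dots$: 1. If $k$ is a multiple of $N$, perform the safeguard: (a) approximately solve the subproblem at $x=z_k$ (in the sense above) to get $\eta_{z_k}$; (b) set $\alpha=1$, $i=0$; while $F(R_{z_k}(\alpha\eta_{z_k}))>F(z_k)-\sigma\alpha\|\eta_{z_k}\|^2$ and $i<N_{\max}$, replace $\alpha$ by $\nu\alpha$ and $i$ by $i+1$; if $i=N_{\max}$, report that the line search fails; (c) if $F(R_{z_k}(\alpha\eta_{z_k}))<F(x_k)$, reset $x_k=y_k=R_{z_k}(\alpha\eta_{z_k})$ and $t_k=1$; otherwise leave $x_k,y_k,t_k$ unchanged; (d) set $z_{k+N}=x_k$. 2. Approximately solve the subproblem at $x=y_k$ (in the sense above) to get $\eta_{y_k}$. 3. $x_{k+1}=R_{y_k}(\eta_{y_k})$. 4. $t_{k+1}=\frac{\sqrt{4t_k^2+1}+1}{2}$. 5. $y_{k+1}=R_{x_{k+1}}\Big(\frac{1-t_k}{t_{k+1}}P_{\mathrm{T}_{x_{k+1}}\mathcal{M}}(x_k-x_{k+1})\Big)$. *)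

theory Defs
  imports "HOL-Analysis.Analysis" "HOL-Library.While_Combinator"
begin

text \<open>
  An \<open>n \<times> q\<close> matrix is an element of \<^typ>\<open>real^'q^'n\<close> (row index first). The library inner product
  and norm of this type are the Frobenius ones.
\<close>

lemma inner_eq_trace: "U \<bullet> V = trace (transpose U ** V)" for U V :: "real^'q^'n"
  unfolding inner_vec_def trace_def matrix_matrix_mult_def transpose_def
  by (simp, rule sum.swap)


section \<open>The manifold and its tangent and normal spaces\<close>

definition Fv :: "real^'n \<Rightarrow> (real^'q^'n) set" where
  "Fv v = {x. transpose x ** x = mat 1 \<and> v \<in> span (columns x)}"

text \<open>
  Since \<open>n - q\<close> is not available as an index type (and may be \<open>0\<close>), a matrix \<open>x\<^sub>\<bottom>\<close> with \<open>n - q\<close> columns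
  is given by the family of its columns, and \<open>K\<close> with \<open>n - q\<close> rows by the family of its rows, both
  indexed by \<open>{..<n - q}\<close>.
\<close>

definition perp_frame :: "real^'q^'n \<Rightarrow> (nat \<Rightarrow> real^'n) \<Rightarrow> bool" where
  \<comment> \<open>the square matrix \<open>(x x\<^sub>\<bottom>)\<close> is orthogonal, for \<open>x\<close> with orthonormal columns\<close>
  "perp_frame x xp \<longleftrightarrow>
     (\<forall>j < CARD('n) - CARD('q). \<forall>l < CARD('n) - CARD('q). xp j \<bullet> xp l = (if j = l then 1 else 0)) \<and>
     (\<forall>j < CARD('n) - CARD('q). \<forall>c. column c x \<bullet> xp j = 0)"

definition perp_mult :: "(nat \<Rightarrow> real^'n) \<Rightarrow> (nat \<Rightarrow> real^'q) \<Rightarrow> real^'q^'n" where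
  \<comment> \<open>the matrix product \<open>x\<^sub>\<bottom> K\<close>\<close>
  "perp_mult xp K = (\<chi> i c. \<Sum>j < CARD('n) - CARD('q). xp j $ i * K j $ c)"

definition tangent_space :: "real^'n \<Rightarrow> real^'q^'n \<Rightarrow> (real^'q^'n) set" where
  \<comment> \<open>the set does not depend on the choice of \<open>x\<^sub>\<bottom>\<close>; the last condition says \<open>K x\<^sup>T v = 0\<close>\<close>
  "tangent_space v x =
     {x ** \<Omega> + perp_mult xp K | xp \<Omega> K. perp_frame x xp \<and> transpose \<Omega> = - \<Omega> \<and>
        (\<forall>j < CARD('n) - CARD('q). K j \<bullet> (transpose x *v v) = 0)}"

definition normal_space_at :: "real^'n \<Rightarrow> real^'q^'n \<Rightarrow> (real^'q^'n) set" where
  "normal_space_at v x = orthogonal_comp (tangent_space v x)"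

definition orth_proj :: "'a::euclidean_space set \<Rightarrow> 'a \<Rightarrow> 'a" where
  "orth_proj S z = (THE p. p \<in> S \<and> z - p \<in> orthogonal_comp S)"

definition tangent_bundle :: "real^'n \<Rightarrow> ((real^'q^'n) \<times> (real^'q^'n)) set" where
  "tangent_bundle v = Sigma (Fv v) (tangent_space v)"

definition orthonormal_basis :: "'a::euclidean_space set \<Rightarrow> nat \<Rightarrow> (nat \<Rightarrow> 'a) \<Rightarrow> bool" where
  "orthonormal_basis S d V \<longleftrightarrow>
     (\<forall>i<d. \<forall>j<d. V i \<bullet> V j = (if i = j then 1 else 0)) \<and> span (V ` {..<d}) = S"

definition normal_dim :: "(real^'q^'n) itself \<Rightarrow> nat" where
  "normal_dim _ = CARD('q) * (CARD('q) + 1) div 2 + CARD('n) - CARD('q)"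


section \<open>Smoothness, gradients, retractions\<close>

fun Ck_on :: "nat \<Rightarrow> 'a::real_normed_vector set \<Rightarrow> ('a \<Rightarrow> 'b::real_normed_vector) \<Rightarrow> bool" where
  "Ck_on 0 S f \<longleftrightarrow> continuous_on S f"
| "Ck_on (Suc k) S f \<longleftrightarrow>
     (\<forall>x\<in>S. f differentiable (at x)) \<and> (\<forall>h. Ck_on k S (\<lambda>x. frechet_derivative f (at x) h))"

definition smooth_on :: "'a::real_normed_vector set \<Rightarrow> ('a \<Rightarrow> 'b::real_normed_vector) \<Rightarrow> bool" where
  \<comment> \<open>to be used for open \<open>S\<close> only\<close>
  "smooth_on S f \<longleftrightarrow> (\<forall>k. Ck_on k S f)"

definition smooth_map_on :: "'a::real_normed_vector set \<Rightarrow> ('a \<Rightarrow> 'b::real_normed_vector) \<Rightarrow> bool" where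
  \<comment> \<open>smoothness on a subset of Euclidean space such as an embedded submanifold: local smooth
     extensions to open sets of the ambient space\<close>
  "smooth_map_on D f \<longleftrightarrow>
     (\<forall>p\<in>D. \<exists>U h. open U \<and> p \<in> U \<and> smooth_on U h \<and> (\<forall>z \<in> U \<inter> D. h z = f z))"

definition gradient :: "('a::euclidean_space \<Rightarrow> real) \<Rightarrow> 'a \<Rightarrow> 'a" where
  "gradient f x = (THE D. GDERIV f x :> D)"

definition riem_grad :: "real^'n \<Rightarrow> (real^'q^'n \<Rightarrow> real) \<Rightarrow> real^'q^'n \<Rightarrow> real^'q^'n" where
  "riem_grad v f x = orth_proj (tangent_space v x) (gradient f x)"

definition manifold_retraction ::
  "real^'n \<Rightarrow> ((real^'q^'n) \<times> (real^'q^'n)) set \<Rightarrow> (real^'q^'n \<Rightarrow> real^'q^'n \<Rightarrow> real^'q^'n) \<Rightarrow> bool" where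
  \<comment> \<open>\<open>D\<close> is the domain of the retraction, an open neighbourhood of the zero section\<close>
  "manifold_retraction v D R \<longleftrightarrow>
     openin (top_of_set (tangent_bundle v)) D \<and>
     (\<forall>x \<in> Fv v. (x, 0) \<in> D) \<and>
     (\<forall>(x, \<eta>) \<in> D. R x \<eta> \<in> Fv v) \<and>
     smooth_map_on D (\<lambda>(x, \<eta>). R x \<eta>) \<and>
     (\<forall>x \<in> Fv v. R x 0 = x) \<and>
     (\<forall>x \<in> Fv v. \<forall>\<eta> \<in> tangent_space v x. ((\<lambda>t. R x (t *\<^sub>R \<eta>)) has_vector_derivative \<eta>) (at 0))"


section \<open>The nonsmooth term, proximal map, stationarity\<close>

definition norm1 :: "real^'q^'n \<Rightarrow> real" where
  "norm1 x = (\<Sum>i\<in>UNIV. \<Sum>j\<in>UNIV. \<bar>x $ i $ j\<bar>)"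

definition prox :: "real \<Rightarrow> ('a::real_normed_vector \<Rightarrow> real) \<Rightarrow> 'a \<Rightarrow> 'a" where
  "prox \<mu> g z = arg_min (\<lambda>w. 1/2 * (norm (w - z))\<^sup>2 + \<mu> * g w) (\<lambda>_. True)"

definition subdifferential :: "('a::real_inner \<Rightarrow> real) \<Rightarrow> 'a \<Rightarrow> 'a set" where
  "subdifferential g x = {s. \<forall>y. g y \<ge> g x + s \<bullet> (y - x)}"

definition stationary ::
  "real^'n \<Rightarrow> (real^'q^'n \<Rightarrow> real) \<Rightarrow> (real^'q^'n \<Rightarrow> real) \<Rightarrow> real^'q^'n \<Rightarrow> bool" where
  "stationary v f g x \<longleftrightarrow>
     0 \<in> orth_proj (tangent_space v x) ` {gradient f x + s | s. s \<in> subdifferential g x}"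

definition accumulation_point :: "(nat \<Rightarrow> 'a::topological_space) \<Rightarrow> 'a \<Rightarrow> bool" where
  "accumulation_point X l \<longleftrightarrow> (\<exists>r. strict_mono r \<and> (X \<circ> r) \<longlonglongrightarrow> l)"


section \<open>The inexact proximal step\<close>

text \<open>
  A vector \<open>\<Lambda> \<in> \<real>\<^sup>d\<close> is a function on \<^typ>\<open>nat\<close> of which only the values on \<open>{..<d}\<close> matter; its
  Euclidean norm is \<open>L2_set \<Lambda> {..<d}\<close>. The argument \<open>V x\<close> is the orthonormal basis of the normal
  space at \<open>x\<close>.
\<close>

definition B_map :: "(real^'q^'n \<Rightarrow> nat \<Rightarrow> real^'q^'n) \<Rightarrow> real^'q^'n \<Rightarrow> (nat \<Rightarrow> real) \<Rightarrow> real^'q^'n" where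
  "B_map V x u = (\<Sum>i < normal_dim TYPE(real^'q^'n). u i *\<^sub>R V x i)"

definition B_adj :: "(real^'q^'n \<Rightarrow> nat \<Rightarrow> real^'q^'n) \<Rightarrow> real^'q^'n \<Rightarrow> real^'q^'n \<Rightarrow> nat \<Rightarrow> real" where
  "B_adj V x W i = trace (transpose W ** V x i)"

context
  fixes v :: "real^'n"
    and f g :: "real^'q^'n \<Rightarrow> real"
    and V :: "real^'q^'n \<Rightarrow> nat \<Rightarrow> real^'q^'n"
    and \<mu> :: real
begin

definition w_step :: "real^'q^'n \<Rightarrow> (nat \<Rightarrow> real) \<Rightarrow> real^'q^'n" where
  "w_step x \<Lambda> = prox \<mu> g (x - \<mu> *\<^sub>R (riem_grad v f x - B_map V x \<Lambda>)) - x"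

definition Psi :: "real^'q^'n \<Rightarrow> (nat \<Rightarrow> real) \<Rightarrow> nat \<Rightarrow> real" where
  "Psi x \<Lambda> = B_adj V x (w_step x \<Lambda>)"

definition w_hat :: "real^'q^'n \<Rightarrow> (nat \<Rightarrow> real) \<Rightarrow> real^'q^'n" where
  "w_hat x \<Lambda> = orth_proj (tangent_space v x) (w_step x \<Lambda>)"

definition approx_solves :: "real \<Rightarrow> real^'q^'n \<Rightarrow> real^'q^'n \<Rightarrow> bool" where
  "approx_solves L\<^sub>g x \<eta> \<longleftrightarrow>
     (\<exists>\<Lambda>. L2_set (Psi x \<Lambda>) {..<normal_dim TYPE(real^'q^'n)}
            \<le> sqrt (4 * \<mu>\<^sup>2 * L\<^sub>g\<^sup>2 + (norm (w_hat x \<Lambda>))\<^sup>2 / 2) - 2 * \<mu> * L\<^sub>g \<and>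
          \<eta> = w_hat x \<Lambda>)"

end


section \<open>The algorithm\<close>

definition line_search ::
  "('a::real_normed_vector \<Rightarrow> real) \<Rightarrow> ('a \<Rightarrow> 'a \<Rightarrow> 'a) \<Rightarrow> real \<Rightarrow> real \<Rightarrow> nat \<Rightarrow> 'a \<Rightarrow> 'a \<Rightarrow> real \<times> nat" where
  \<comment> \<open>the final values of the step size \<open>\<alpha>\<close> and of the counter \<open>i\<close>\<close>
  "line_search F R \<sigma> \<nu> N_max z \<eta> =
     while (\<lambda>(\<alpha>, i). F (R z (\<alpha> *\<^sub>R \<eta>)) > F z - \<sigma> * \<alpha> * (norm \<eta>)\<^sup>2 \<and> i < N_max)
           (\<lambda>(\<alpha>, i). (\<nu> * \<alpha>, i + 1))
           (1, 0)"

text \<open>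
  \<open>AManPG \<dots> x\<^sub>0 z\<close> says that \<open>z\<close> is produced by an infinite run of the algorithm started at \<open>x\<^sub>0\<close>; only the
  values of \<open>z\<close> at multiples of \<open>N\<close> are constrained. The functions \<open>x\<close>, \<open>y\<close>, \<open>t\<close> are the iterates at the
  beginning of iteration \<open>k\<close>, and \<open>x'\<close>, \<open>y'\<close>, \<open>t'\<close> those after its (possible) safeguard. A run in
  which the line search reports failure stops there, so failure never occurs in an infinite run.
  Wherever the run evaluates the retraction, its argument must belong to the domain \<open>D\<close>.
\<close>

definition AManPG ::
  "real^'n \<Rightarrow> (real^'q^'n \<Rightarrow> real) \<Rightarrow> (real^'q^'n \<Rightarrow> real) \<Rightarrow> (real^'q^'n \<Rightarrow> nat \<Rightarrow> real^'q^'n) \<Rightarrow>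
   ((real^'q^'n) \<times> (real^'q^'n)) set \<Rightarrow> (real^'q^'n \<Rightarrow> real^'q^'n \<Rightarrow> real^'q^'n) \<Rightarrow>
   real \<Rightarrow> real \<Rightarrow> real \<Rightarrow> real \<Rightarrow> nat \<Rightarrow> nat \<Rightarrow>
   real^'q^'n \<Rightarrow> (nat \<Rightarrow> real^'q^'n) \<Rightarrow> bool" where
  "AManPG v f g V D R L\<^sub>g \<mu> \<sigma> \<nu> N N_max x\<^sub>0 z \<longleftrightarrow>
    (let F = (\<lambda>x. f x + g x) in
     \<exists>x y t x' y' t' \<eta>z \<eta>y.
       t 0 = (1::real) \<and> x 0 = x\<^sub>0 \<and> y 0 = x\<^sub>0 \<and> z 0 = x\<^sub>0 \<and>
       (\<forall>k.
         (if N dvd k then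
            approx_solves v f g V \<mu> L\<^sub>g (z k) (\<eta>z k) \<and>
            (let (\<alpha>, i) = line_search F R \<sigma> \<nu> N_max (z k) (\<eta>z k) in
               (\<forall>j\<le>i. (z k, \<nu> ^ j *\<^sub>R \<eta>z k) \<in> D) \<and>
               i \<noteq> N_max \<and>
               (if F (R (z k) (\<alpha> *\<^sub>R \<eta>z k)) < F (x k)
                then x' k = R (z k) (\<alpha> *\<^sub>R \<eta>z k) \<and> y' k = R (z k) (\<alpha> *\<^sub>R \<eta>z k) \<and> t' k = 1
                else x' k = x k \<and> y' k = y k \<and> t' k = t k)) \<and>
            z (k + N) = x' k
          else x' k = x k \<and> y' k = y k \<and> t' k = t k) \<and>
         approx_solves v f g V \<mu> L\<^sub>g (y' k) (\<eta>y k) \<and>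
         (y' k, \<eta>y k) \<in> D \<and>
         x (Suc k) = R (y' k) (\<eta>y k) \<and>
         t (Suc k) = (sqrt (4 * (t' k)\<^sup>2 + 1) + 1) / 2 \<and>
         (let \<zeta> = ((1 - t' k) / t (Suc k)) *\<^sub>R
                    orth_proj (tangent_space v (x (Suc k))) (x' k - x (Suc k))
          in (x (Suc k), \<zeta>) \<in> D \<and> y (Suc k) = R (x (Suc k)) \<zeta>)))"

end

(* Each safeguard decreases F by at least sigma * nu^N_max * |eta|^2, and F is bounded below by its
   value at the accumulation point, so eta -> 0 along z_0, z_N, z_2N, ... The stopping criterion
   bounds the normal component |Psi| of the inexact step w by |eta|, hence w -> 0 too. The optimality
   condition of the proximal map gives a subgradient s of g at z + w for which the tangential
   component of grad f(z) + s is that of -w/mu. Subgradients are bounded by L_g, so s converges along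
   a further subsequence; the graph of the subdifferential is closed, and every tangent vector at the
   limit point is a limit of tangent vectors at the iterates, so grad f + s is normal in the limit. *)

theory Submission
  imports Defs
begin

section \<open>Matrices and orthonormal bases\<close>

lemma tendsto_matrix_matrix_mult:
  fixes A :: "'a \<Rightarrow> real^'n^'m" and B :: "'a \<Rightarrow> real^'p^'n"
  assumes "(A \<longlongrightarrow> a) F" "(B \<longlongrightarrow> b) F"
  shows "((\<lambda>k. A k ** B k) \<longlongrightarrow> a ** b) F"
  unfolding matrix_matrix_mult_def
  by (intro vec_tendstoI) (auto intro!: tendsto_intros assms)

lemma tendsto_matrix_vector_mult:
  fixes A :: "'a \<Rightarrow> real^'n^'m"
  assumes "(A \<longlongrightarrow> a) F" "(u \<longlongrightarrow> b) F"
  shows "((\<lambda>k. A k *v u k) \<longlongrightarrow> a *v b) F"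
  unfolding matrix_vector_mult_def
  by (intro vec_tendstoI) (auto intro!: tendsto_intros assms)

lemma tendsto_transpose:
  fixes A :: "'a \<Rightarrow> real^'n^'m"
  assumes "(A \<longlongrightarrow> a) F"
  shows "((\<lambda>k. transpose (A k)) \<longlongrightarrow> transpose a) F"
  unfolding transpose_def
  by (intro vec_tendstoI) (auto intro!: tendsto_intros assms)

lemma transpose_add: "transpose (A + B) = transpose A + transpose B" for A B :: "real^'n^'m"
  by (simp add: transpose_def vec_eq_iff)

lemma matrix_diff_ldistrib: "A ** (B - C) = A ** B - A ** C"
  for A :: "real^'n^'m" and B C :: "real^'p^'n"
  by (simp add: vec_eq_iff matrix_matrix_mult_def sum_subtractf right_diff_distrib)

lemma transpose_mult_eq_0_iff:
  fixes x :: "real^'q^'n" and W :: "real^'p^'n"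
  shows "transpose x ** W = 0 \<longleftrightarrow> (\<forall>c d. column c x \<bullet> column d W = 0)"
  by (auto simp: vec_eq_iff matrix_matrix_mult_def transpose_def column_def inner_vec_def)

lemma transpose_mult_eq_1_iff:
  fixes x :: "real^'q^'n"
  shows "transpose x ** x = mat 1 \<longleftrightarrow> (\<forall>c d. column c x \<bullet> column d x = (if c = d then 1 else 0))"
  by (simp add: vec_eq_iff matrix_matrix_mult_def transpose_def column_def inner_vec_def mat_def)

lemma span_columns_eq: "span (columns x) = range ((*v) x)" for x :: "real^'q^'n"
proof
  have "columns x \<subseteq> range ((*v) x)"
    by (auto simp: columns_image_basis)
  moreover have "subspace (range ((*v) x))"
    by (intro linear_subspace_image matrix_vector_mul_linear subspace_UNIV)
  ultimately show "span (columns x) \<subseteq> range ((*v) x)"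
    by (rule span_minimal)
  show "range ((*v) x) \<subseteq> span (columns x)"
    using matrix_vector_mult_in_columnspace by blast
qed

text \<open>Both sides are linear in \<open>w\<close>, so induction over the span only has to add a
  multiple of one basis vector, for which orthonormality leaves a single term of the sum.\<close>

lemma orthonormal_basis_sum:
  fixes V :: "nat \<Rightarrow> 'a::euclidean_space"
  assumes "orthonormal_basis S d V" "w \<in> S"
  shows "w = (\<Sum>i<d. (V i \<bullet> w) *\<^sub>R V i)"
proof -
  have on: "V i \<bullet> V j = (if i = j then 1 else 0)" if "i < d" "j < d" for i j
    using assms(1) that by (simp add: orthonormal_basis_def)
  have "w \<in> span (V ` {..<d})"
    using assms by (simp add: orthonormal_basis_def)
  then show ?thesis
  proof (induction rule: span_induct_alt)
    case (step c b y)
    then obtain j where j: "j < d" "b = V j"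
      by auto
    have "(\<Sum>i<d. (V i \<bullet> (c *\<^sub>R b + y)) *\<^sub>R V i) =
            (\<Sum>i<d. (if i = j then c *\<^sub>R V i else 0) + (V i \<bullet> y) *\<^sub>R V i)"
      using on j by (intro sum.cong) (auto simp: inner_add_right algebra_simps)
    then show ?case
      using step(2) j by (simp add: sum.distrib)
  qed simp
qed

text \<open>Parseval's identity. It will turn the Euclidean norm of the coordinate vector
  \<open>Psi\<close> into the Frobenius norm of the normal component of the step.\<close>

lemma L2_set_orthonormal_basis:
  fixes V :: "nat \<Rightarrow> 'a::euclidean_space"
  assumes "orthonormal_basis S d V" "w \<in> S"
  shows "L2_set (\<lambda>i. V i \<bullet> w) {..<d} = norm w"
proof -
  have "w \<bullet> w = w \<bullet> (\<Sum>i<d. (V i \<bullet> w) *\<^sub>R V i)"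
    using orthonormal_basis_sum[OF assms] by simp
  then have "w \<bullet> w = (\<Sum>i<d. (V i \<bullet> w)\<^sup>2)"
    by (simp add: inner_sum_right power2_eq_square inner_commute)
  then show ?thesis
    by (simp add: L2_set_def norm_eq_sqrt_inner)
qed

text \<open>The difference of two candidates lies in \<open>S\<close> and in its orthogonal
  complement, hence is orthogonal to itself. This is the uniqueness half of the definite description
  in \<open>orth_proj\<close>.\<close>

lemma orth_proj_unique:
  assumes "subspace S" "p \<in> S" "z - p \<in> orthogonal_comp S"
  shows "orth_proj S z = p"
  unfolding orth_proj_def
proof (rule the_equality)
  fix p' assume p': "p' \<in> S \<and> z - p' \<in> orthogonal_comp S"
  then have "p' - p \<in> S"
    using assms by (simp add: subspace_diff)
  moreover have "p' - p \<in> orthogonal_comp S"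
    using subspace_diff[OF subspace_orthogonal_comp assms(3)] p' by fastforce
  ultimately show "p' = p"
    by (auto simp: orthogonal_comp_def orthogonal_def)
qed (use assms in blast)

lemma orth_proj_decomp:
  assumes "subspace S"
  shows "orth_proj S z \<in> S" "z - orth_proj S z \<in> orthogonal_comp S"
proof -
  have "span S = S"
    using assms by simp
  then obtain p n where "p \<in> S" "\<And>w. w \<in> S \<Longrightarrow> orthogonal n w" "z = p + n"
    using orthogonal_subspace_decomp_exists[of S z] by metis
  then have p: "p \<in> S" "z - p \<in> orthogonal_comp S"
    by (auto simp: orthogonal_comp_def orthogonal_commute)
  then show "orth_proj S z \<in> S" "z - orth_proj S z \<in> orthogonal_comp S"
    using orth_proj_unique[OF assms p] by simp_all
qed

section \<open>The tangent space\<close>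

lemma dim_columns:
  fixes x :: "real^'q^'n"
  assumes "transpose x ** x = mat 1"
  shows "dim (columns x) = CARD('q)"
proof -
  have orth: "column c x \<bullet> column d x = (if c = d then 1 else 0)" for c d
    using assms by (simp add: transpose_mult_eq_1_iff)
  have cols: "columns x = range (\<lambda>c. column c x)"
    by (auto simp: columns_def)
  have "inj (\<lambda>c. column c x)"
    using orth by (metis injI zero_neq_one)
  moreover have "independent (columns x)"
  proof (rule pairwise_orthogonal_independent)
    show "pairwise orthogonal (columns x)"
      using orth by (auto simp: cols pairwise_def orthogonal_def)
    show "0 \<notin> columns x"
      using orth by (auto simp: cols) (metis inner_zero_left zero_neq_one)
  qed
  ultimately show ?thesis
    by (simp add: dim_eq_card_independent card_image cols)
qed

text \<open>The frame enumerates an orthonormal basis of the orthogonal complement of the column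
  space, whose dimension is n - q. \<open>perp_frame\<close> itself only asserts orthogonality
  relations; the second conclusion adds that the frame spans this complement.\<close>

lemma obtain_perp_frame:
  fixes x :: "real^'q^'n"
  assumes "transpose x ** x = mat 1"
  obtains xp where "perp_frame x xp"
    and "\<And>w. (\<And>c. column c x \<bullet> w = 0) \<Longrightarrow>
           w = (\<Sum>j < CARD('n) - CARD('q). (xp j \<bullet> w) *\<^sub>R xp j)"
proof -
  let ?m = "CARD('n) - CARD('q)"
  define S where "S = {w. \<forall>u \<in> span (columns x). orthogonal u w}"
  have S: "w \<in> S \<longleftrightarrow> (\<forall>c. column c x \<bullet> w = 0)" for w
  proof
    show "w \<in> S \<Longrightarrow> \<forall>c. column c x \<bullet> w = 0"
      unfolding S_def orthogonal_def columns_def by (auto intro: span_base)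
    assume "\<forall>c. column c x \<bullet> w = 0"
    then have "\<forall>u \<in> columns x. orthogonal w u"
      by (auto simp: columns_def orthogonal_def inner_commute)
    then show "w \<in> S"
      unfolding S_def using orthogonal_to_span orthogonal_commute by blast
  qed
  have sub: "subspace S"
    unfolding S_def by (rule subspace_orthogonal_to_vectors)
  have "dim S + dim (span (columns x)) = dim (UNIV :: (real^'n) set)"
    unfolding S_def
    using dim_subspace_orthogonal_to_vectors[of "span (columns x)" UNIV] by simp
  then have dimS: "dim S = ?m"
    by (simp add: dim_columns[OF assms])
  obtain B where B: "B \<subseteq> S" "pairwise orthogonal B" "\<And>b. b \<in> B \<Longrightarrow> norm b = 1"
    "independent B" "card B = dim S" "span B = S"
    using orthonormal_basis_subspace[OF sub] by metis
  have fin: "finite B"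
    using B(4) independent_imp_finite by blast
  obtain xp where xp: "bij_betw xp {..<?m} B"
    using ex_bij_betw_nat_finite[OF fin] by (auto simp: B(5) dimS atLeast0LessThan)
  have xpB: "xp j \<in> B" if "j < ?m" for j
    using xp that by (auto simp: bij_betw_def)
  have on: "xp j \<bullet> xp l = (if j = l then 1 else 0)" if "j < ?m" "l < ?m" for j l
  proof (cases "j = l")
    case True
    then show ?thesis
      using B(3)[OF xpB[OF that(1)]] by (simp add: dot_square_norm)
  next
    case False
    then have "xp j \<noteq> xp l"
      using xp that by (auto simp: bij_betw_def inj_on_def)
    then show ?thesis
      using B(2) xpB that False by (auto simp: pairwise_def orthogonal_def)
  qed
  have "column c x \<bullet> xp j = 0" if "j < ?m" for c j
    using xpB[OF that] B(1) S by blast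
  with on have "perp_frame x xp"
    by (simp add: perp_frame_def)
  moreover have basis: "orthonormal_basis S ?m xp"
    using on xp B(6) by (simp add: orthonormal_basis_def bij_betw_def)
  have "w = (\<Sum>j<?m. (xp j \<bullet> w) *\<^sub>R xp j)" if "\<And>c. column c x \<bullet> w = 0" for w
    using orthonormal_basis_sum[OF basis] that S by blast
  ultimately show thesis
    using that by blast
qed

lemma perp_mult_vector:
  fixes xp :: "nat \<Rightarrow> real^'n" and K :: "nat \<Rightarrow> real^'q"
  shows "perp_mult xp K *v u = (\<Sum>j < CARD('n) - CARD('q). (K j \<bullet> u) *\<^sub>R xp j)"
proof (unfold vec_eq_iff, rule allI)
  fix i
  have "(perp_mult xp K *v u) $ i =
      (\<Sum>c\<in>UNIV. \<Sum>j < CARD('n) - CARD('q). xp j $ i * K j $ c * u $ c)"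
    by (simp add: perp_mult_def matrix_vector_mult_def sum_distrib_right)
  also have "\<dots> = (\<Sum>j < CARD('n) - CARD('q). \<Sum>c\<in>UNIV. xp j $ i * K j $ c * u $ c)"
    by (rule sum.swap)
  also have "\<dots> = (\<Sum>j < CARD('n) - CARD('q). (K j \<bullet> u) *\<^sub>R xp j) $ i"
    by (simp add: inner_vec_def sum_distrib_left mult_ac)
  finally show "(perp_mult xp K *v u) $ i = (\<Sum>j < CARD('n) - CARD('q). (K j \<bullet> u) *\<^sub>R xp j) $ i" .
qed

text \<open>As K varies, x_perp K runs through all \<open>W\<close> whose columns are orthogonal to
  those of \<open>x\<close>. This description involves no choice of a frame, so it can be followed
  along a convergent sequence of points.\<close>

lemma tangent_space_altdef:
  fixes v :: "real^'n" and x :: "real^'q^'n"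
  assumes "transpose x ** x = mat 1"
  shows "tangent_space v x =
     {x ** \<Omega> + W | \<Omega> W. transpose \<Omega> = - \<Omega> \<and> transpose x ** W = 0 \<and> W *v (transpose x *v v) = 0}"
    (is "_ = ?T")
proof (intro equalityI subsetI)
  fix \<xi> assume "\<xi> \<in> tangent_space v x"
  then obtain xp \<Omega> K where \<xi>: "\<xi> = x ** \<Omega> + perp_mult xp K" and xp: "perp_frame x xp"
    and \<Omega>: "transpose \<Omega> = - \<Omega>"
    and K: "\<forall>j < CARD('n) - CARD('q). K j \<bullet> (transpose x *v v) = 0"
    unfolding tangent_space_def by blast
  have "column c x \<bullet> column d (perp_mult xp K) = 0" for c d
  proof -
    have "column c x \<bullet> column d (perp_mult xp K) =
        column c x \<bullet> (\<Sum>j < CARD('n) - CARD('q). K j $ d *\<^sub>R xp j)"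
      by (rule arg_cong[where f = "(\<bullet>) _"]) (simp add: vec_eq_iff column_def perp_mult_def mult.commute)
    then show ?thesis
      using xp by (simp add: inner_sum_right perp_frame_def)
  qed
  then have "transpose x ** perp_mult xp K = 0"
    by (simp add: transpose_mult_eq_0_iff)
  moreover have "perp_mult xp K *v (transpose x *v v) = 0"
    using K by (simp add: perp_mult_vector)
  ultimately show "\<xi> \<in> ?T"
    using \<xi> \<Omega> by blast
next
  fix \<xi> assume "\<xi> \<in> ?T"
  then obtain \<Omega> W where \<xi>: "\<xi> = x ** \<Omega> + W" and \<Omega>: "transpose \<Omega> = - \<Omega>"
    and W: "transpose x ** W = 0" "W *v (transpose x *v v) = 0"
    by blast
  obtain xp where xp: "perp_frame x xp"
    and expand: "\<And>w. (\<And>c. column c x \<bullet> w = 0) \<Longrightarrow>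
           w = (\<Sum>j < CARD('n) - CARD('q). (xp j \<bullet> w) *\<^sub>R xp j)"
    using obtain_perp_frame[OF assms] by blast
  \<comment> \<open>K = x_perp^T W: row \<open>j\<close> holds the coordinates of the columns of
    \<open>W\<close> along \<open>xp j\<close>, so expanding the columns in the frame gives back
    \<open>W\<close>.\<close>
  define K where "K j = transpose W *v xp j" for j
  have Kd: "K j $ d = xp j \<bullet> column d W" for j d
    by (simp add: K_def matrix_vector_mult_def transpose_def column_def inner_vec_def mult.commute)
  have "W = perp_mult xp K"
  proof (unfold vec_eq_iff, intro allI)
    fix i d
    have "column d W = (\<Sum>j < CARD('n) - CARD('q). (xp j \<bullet> column d W) *\<^sub>R xp j)"
      using W(1) by (intro expand) (simp add: transpose_mult_eq_0_iff)
    then have "column d W $ i = (\<Sum>j < CARD('n) - CARD('q). (xp j \<bullet> column d W) *\<^sub>R xp j) $ i"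
      by simp
    then show "W $ i $ d = perp_mult xp K $ i $ d"
      by (simp add: perp_mult_def Kd mult.commute) (simp add: column_def)
  qed
  moreover have "K j \<bullet> (transpose x *v v) = 0" for j
  proof -
    have "K j \<bullet> (transpose x *v v) = xp j \<bullet> (W *v (transpose x *v v))"
      by (simp add: K_def dot_lmul_matrix flip: vector_transpose_matrix)
    then show ?thesis
      using W(2) by simp
  qed
  ultimately show "\<xi> \<in> tangent_space v x"
    unfolding tangent_space_def using \<xi> \<Omega> xp by blast
qed

text \<open>In the definition two tangent vectors may come with different frames. In the frame-free
  description all conditions are linear in \<open>\<Omega>\<close> and \<open>W\<close>.\<close>

lemma subspace_tangent_space:
  fixes x :: "real^'q^'n"
  assumes "transpose x ** x = mat 1"
  shows "subspace (tangent_space v x)"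
  unfolding tangent_space_altdef[OF assms]
proof (intro subspaceI)
  let ?T = "{x ** \<Omega> + W |\<Omega> W.
     transpose \<Omega> = - \<Omega> \<and> transpose x ** W = 0 \<and> W *v (transpose x *v v) = 0}"
  have z: "transpose (0::real^'q^'q) = - 0"
    by (simp add: transpose_def vec_eq_iff)
  show "0 \<in> ?T"
    by (rule CollectI, rule exI[of _ 0], rule exI[of _ 0]) (use z in simp)
  show "a + b \<in> ?T" if ab: "a \<in> ?T" "b \<in> ?T" for a b
  proof -
    obtain \<Omega> W \<Omega>' W' where *: "a = x ** \<Omega> + W" "b = x ** \<Omega>' + W'"
      "transpose \<Omega> = - \<Omega>" "transpose x ** W = 0" "W *v (transpose x *v v) = 0"
      "transpose \<Omega>' = - \<Omega>'" "transpose x ** W' = 0" "W' *v (transpose x *v v) = 0"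
      using ab by blast
    have "a + b = x ** (\<Omega> + \<Omega>') + (W + W')"
      by (simp add: * matrix_add_ldistrib)
    moreover have "transpose (\<Omega> + \<Omega>') = - (\<Omega> + \<Omega>')"
      using *(3,6) by (simp add: transpose_add)
    moreover have "transpose x ** (W + W') = 0" "(W + W') *v (transpose x *v v) = 0"
      using * by (simp_all add: matrix_add_ldistrib matrix_vector_mult_add_rdistrib)
    ultimately show ?thesis by blast
  qed
  show "c *\<^sub>R a \<in> ?T" if a: "a \<in> ?T" for c a
  proof -
    obtain \<Omega> W where *: "a = x ** \<Omega> + W"
      "transpose \<Omega> = - \<Omega>" "transpose x ** W = 0" "W *v (transpose x *v v) = 0"
      using a by blast
    have "c *\<^sub>R a = x ** (c *\<^sub>R \<Omega>) + c *\<^sub>R W"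
      by (simp add: * scaleR_add_right matrix_scalar_ac flip: scalar_matrix_assoc)
    moreover have "transpose (c *\<^sub>R \<Omega>) = - (c *\<^sub>R \<Omega>)"
      using *(2) by (simp add: transpose_scalar)
    moreover have "transpose x ** (c *\<^sub>R W) = 0" "(c *\<^sub>R W) *v (transpose x *v v) = 0"
      using * by (simp_all add: matrix_scalar_ac flip: scalar_matrix_assoc scaleR_matrix_vector_assoc)
    ultimately show ?thesis by blast
  qed
qed

section \<open>The manifold\<close>

text \<open>For orthonormal columns, x x^T is the orthogonal projection onto the column space and
  fixes exactly the vectors of that space. Membership becomes a pair of polynomial equations in
  \<open>x\<close>, which survive limits.\<close>

lemma Fv_iff:
  fixes v :: "real^'n" and x :: "real^'q^'n"
  shows "x \<in> Fv v \<longleftrightarrow> transpose x ** x = mat 1 \<and> x *v (transpose x *v v) = v"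
proof -
  have "x *v (transpose x *v (x *v a)) = x *v a" if "transpose x ** x = mat 1" for a
    by (simp only: matrix_vector_mul_assoc[of "transpose x"] that matrix_vector_mul_lid)
  moreover have "v \<in> range ((*v) x)" if "x *v (transpose x *v v) = v"
    using that by (metis rangeI)
  ultimately show ?thesis
    unfolding Fv_def span_columns_eq mem_Collect_eq by blast
qed

lemma closed_Fv: "closed (Fv v :: (real^'q^'n) set)"
  unfolding closed_sequential_limits
proof (intro allI impI, elim conjE)
  fix X and l :: "real^'q^'n"
  assume X: "\<forall>n. X n \<in> Fv v" and lim: "X \<longlonglongrightarrow> l"
  have "(\<lambda>n. transpose (X n) ** X n) \<longlonglongrightarrow> transpose l ** l"
    by (intro tendsto_matrix_matrix_mult tendsto_transpose lim)
  then have "transpose l ** l = mat 1"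
    using X by (simp add: Fv_iff LIMSEQ_const_iff)
  moreover have "(\<lambda>n. X n *v (transpose (X n) *v v)) \<longlonglongrightarrow> l *v (transpose l *v v)"
    by (intro tendsto_matrix_vector_mult tendsto_transpose lim tendsto_const)
  then have "l *v (transpose l *v v) = v"
    using X by (simp add: Fv_iff LIMSEQ_const_iff)
  ultimately show "l \<in> Fv v"
    by (simp add: Fv_iff)
qed

text \<open>One explicit formula gives all the approximants: keep \<open>\<Omega>\<close>, and
  correct \<open>W\<close> by a map continuous in the base point that enforces both constraints
  there and changes nothing at \<open>l\<close>.\<close>

lemma tangent_space_lower_semicontinuous:
  fixes X :: "nat \<Rightarrow> real^'q^'n"
  assumes X: "\<And>k. X k \<in> Fv v" and lim: "X \<longlonglongrightarrow> l" and "v \<noteq> 0" and \<xi>: "\<xi> \<in> tangent_space v l"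
  obtains Y where "\<And>k. Y k \<in> tangent_space v (X k)" "Y \<longlonglongrightarrow> \<xi>"
proof -
  have l: "l \<in> Fv v"
    using closed_sequentially[OF closed_Fv] X lim by blast
  obtain \<Omega> W where \<xi>_eq: "\<xi> = l ** \<Omega> + W" and \<Omega>: "transpose \<Omega> = - \<Omega>"
    and W: "transpose l ** W = 0" "W *v (transpose l *v v) = 0"
    using \<xi> l by (auto simp: tangent_space_altdef Fv_iff)
  define u where "u x = transpose x *v v" for x :: "real^'q^'n"
  \<comment> \<open>correct \<open>W\<close> first to annihilate \<open>x\<^sup>T v\<close>, then to be orthogonal to the columns of \<open>x\<close>\<close>
  define P :: "real^'q^'n \<Rightarrow> real^'q^'n"
    where "P x = W - (\<chi> i c. (W *v u x) $ i * u x $ c / (v \<bullet> v))" for x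
  define Y where "Y x = x ** \<Omega> + (P x - x ** (transpose x ** P x))" for x
  have "Y x \<in> tangent_space v x" if x: "x \<in> Fv v" for x
  proof -
    have x1: "transpose x ** x = mat 1" and xv: "x *v u x = v"
      using x by (auto simp: Fv_iff u_def)
    \<comment> \<open>Since \<open>v\<close> lies in the column space, x^T preserves its length. The
      fixed denominator \<open>v \<bullet> v\<close> is therefore also
      \<open>u x \<bullet> u x\<close>, and the rank-one correction in \<open>P\<close> cancels
      \<open>W *v u x\<close> exactly.\<close>
    have "u x \<bullet> u x = v \<bullet> (x *v u x)"
      by (simp add: u_def dot_lmul_matrix flip: vector_transpose_matrix)
    then have uu: "u x \<bullet> u x = v \<bullet> v"
      by (simp add: xv)
    have "(\<chi> i c. (W *v u x) $ i * u x $ c / (v \<bullet> v)) *v u x = ((u x \<bullet> u x) / (v \<bullet> v)) *\<^sub>R (W *v u x)"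
      by (simp add: vec_eq_iff matrix_vector_mult_def[of "vec_lambda _"] inner_vec_def[of "u x"]
          sum_divide_distrib sum_distrib_left sum_distrib_right mult_ac)
    then have Pu: "P x *v u x = 0"
      using \<open>v \<noteq> 0\<close> by (simp add: P_def uu matrix_vector_mult_diff_rdistrib)
    have "transpose x ** (P x - x ** (transpose x ** P x)) = 0"
      by (simp add: matrix_diff_ldistrib matrix_mul_assoc x1)
    \<comment> \<open>The second correction multiplies \<open>P x\<close> from the left, so what
      \<open>P x\<close> annihilates stays annihilated.\<close>
    moreover have "(P x - x ** (transpose x ** P x)) *v u x = 0"
      by (simp add: matrix_vector_mult_diff_rdistrib Pu flip: matrix_vector_mul_assoc)
    ultimately show ?thesis
      unfolding tangent_space_altdef[OF x1] Y_def u_def[symmetric] using \<Omega> by blast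
  qed
  moreover have "(\<lambda>k. Y (X k)) \<longlonglongrightarrow> \<xi>"
  proof -
    have u: "(\<lambda>k. u (X k)) \<longlonglongrightarrow> u l"
      unfolding u_def by (intro tendsto_matrix_vector_mult tendsto_transpose lim tendsto_const)
    have P: "(\<lambda>k. P (X k)) \<longlonglongrightarrow> P l"
      unfolding P_def using \<open>v \<noteq> 0\<close>
      by (intro tendsto_diff tendsto_const vec_tendstoI)
         (auto intro!: tendsto_intros tendsto_matrix_vector_mult u)
    have "(\<lambda>k. Y (X k)) \<longlonglongrightarrow> Y l"
      unfolding Y_def by (intro tendsto_intros tendsto_matrix_matrix_mult tendsto_transpose lim P)
    \<comment> \<open>Both corrections vanish at \<open>l\<close>, where \<open>W\<close> already
      satisfies the two constraints.\<close>
    moreover have "P l = W"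
      using W(2) by (simp add: P_def u_def vec_eq_iff)
    then have "Y l = \<xi>"
      by (simp add: Y_def \<xi>_eq W(1))
    ultimately show ?thesis by simp
  qed
  ultimately show thesis
    using that[of "\<lambda>k. Y (X k)"] X by blast
qed

section \<open>Proximal maps and subgradients\<close>

text \<open>\<open>arg_min\<close> is a choice, so a minimizer must be shown to exist. Compactness
  gives one over a ball around \<open>z\<close>; outside the ball the quadratic term alone exceeds
  the value at \<open>z\<close>, because \<open>g\<close> is nonnegative.\<close>

lemma prox_minimizes:
  fixes g :: "'a::euclidean_space \<Rightarrow> real"
  assumes cont: "continuous_on UNIV g" and nonneg: "\<And>w. g w \<ge> 0" and "\<mu> > 0"
  shows "1/2 * (norm (prox \<mu> g z - z))\<^sup>2 + \<mu> * g (prox \<mu> g z) \<le> 1/2 * (norm (w - z))\<^sup>2 + \<mu> * g w"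
proof -
  define \<phi> where "\<phi> = (\<lambda>w. 1/2 * (norm (w - z))\<^sup>2 + \<mu> * g w)"
  \<comment> \<open>With this radius, half of its square is \<open>\<mu> * g z\<close>, the value of
    the objective at the centre.\<close>
  define r where "r = sqrt (2 * \<mu> * g z)"
  have r: "r \<ge> 0" "r\<^sup>2 = 2 * \<mu> * g z"
    using nonneg[of z] \<open>\<mu> > 0\<close> by (auto simp: r_def)
  have "continuous_on (cball z r) \<phi>"
    unfolding \<phi>_def by (intro continuous_intros continuous_on_subset[OF cont]) auto
  then obtain p where p: "p \<in> cball z r" "\<And>w. w \<in> cball z r \<Longrightarrow> \<phi> p \<le> \<phi> w"
    using continuous_attains_inf[of "cball z r" \<phi>] r(1) by auto
  have min: "\<phi> p \<le> \<phi> w" for w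
  proof (cases "w \<in> cball z r")
    case False
    then have "r < norm (w - z)"
      by (simp add: dist_norm norm_minus_commute)
    then have "r\<^sup>2 < (norm (w - z))\<^sup>2"
      using r(1) by (intro power_strict_mono) auto
    moreover have "0 \<le> \<mu> * g w"
      using nonneg[of w] \<open>\<mu> > 0\<close> by simp
    ultimately have "\<phi> z \<le> \<phi> w"
      using r(2) by (simp add: \<phi>_def)
    then show ?thesis
      using p(2)[of z] r(1) by simp
  qed (use p in blast)
  have "\<phi> (arg_min \<phi> (\<lambda>_. True)) \<le> \<phi> w"
    by (rule arg_minI[where x = p]) (use min in \<open>auto simp: not_less\<close>)
  then show ?thesis
    by (simp add: prox_def \<phi>_def)
qed

text \<open>Fermat's rule: compare the minimizer with the points of the segment towards
  \<open>y\<close>, bound \<open>g\<close> there by convexity, divide by the segment parameter and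
  let it tend to 0.\<close>

lemma prox_subgradient:
  fixes g :: "'a::euclidean_space \<Rightarrow> real"
  assumes cont: "continuous_on UNIV g" and nonneg: "\<And>w. g w \<ge> 0" and convex: "convex_on UNIV g"
    and "\<mu> > 0"
  shows "(1 / \<mu>) *\<^sub>R (z - prox \<mu> g z) \<in> subdifferential g (prox \<mu> g z)"
  unfolding subdifferential_def
proof (intro CollectI allI)
  fix y
  define p where "p = prox \<mu> g z"
  \<comment> \<open>Along \<open>p + t *\<^sub>R (y - p)\<close> the quadratic term has first-order
    coefficient \<open>d\<close> and second-order coefficient \<open>e\<close>. The target
    \<open>c \<ge> 0\<close> is the subgradient inequality at \<open>y\<close> multiplied by
    \<open>\<mu>\<close>.\<close>
  define d e c where "d = (y - p) \<bullet> (p - z)" and "e = 1/2 * (norm (y - p))\<^sup>2"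
    and "c = d + \<mu> * (g y - g p)"
  have ge: "c + t * e \<ge> 0" if t: "0 < t" "t < 1" for t
  proof -
    define w where "w = p + t *\<^sub>R (y - p)"
    have "g w = g ((1 - t) *\<^sub>R p + t *\<^sub>R y)"
      by (simp add: w_def algebra_simps)
    also have "\<dots> \<le> (1 - t) * g p + t * g y"
      using convex_onD[OF convex, of t p y] t by simp
    finally have gw: "\<mu> * g w \<le> \<mu> * ((1 - t) * g p + t * g y)"
      using \<open>\<mu> > 0\<close> by simp
    have "(norm (a + t *\<^sub>R b))\<^sup>2 = (norm a)\<^sup>2 + 2 * t * (b \<bullet> a) + t\<^sup>2 * (norm b)\<^sup>2" for a b :: 'a
      unfolding power2_norm_eq_inner
      by (simp add: inner_add_left inner_add_right inner_commute[of b a] power2_eq_square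
          distrib_left mult.assoc)
    from this[of "p - z" "y - p"] have nw: "1/2 * (norm (w - z))\<^sup>2 = 1/2 * (norm (p - z))\<^sup>2 + t * d + t\<^sup>2 * e"
      by (simp add: w_def d_def e_def diff_add_eq)
    have "1/2 * (norm (p - z))\<^sup>2 + \<mu> * g p \<le> 1/2 * (norm (w - z))\<^sup>2 + \<mu> * g w"
      unfolding p_def by (rule prox_minimizes[OF cont nonneg \<open>\<mu> > 0\<close>])
    then have "0 \<le> t * (c + t * e)"
      using gw unfolding nw by (simp add: c_def power2_eq_square algebra_simps)
    then show ?thesis
      using t(1) by (simp add: zero_le_mult_iff)
  qed
  have "((\<lambda>t. c + t * e) \<longlongrightarrow> c + 0 * e) (at_right 0)"
    by (intro tendsto_intros)
  moreover have "\<forall>\<^sub>F t in at_right 0. c + t * e \<ge> 0"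
    unfolding eventually_at_right_field using ge by (intro exI[of _ 1]) auto
  ultimately have "c + 0 * e \<ge> 0"
    by (rule tendsto_lowerbound) simp
  then have "\<mu> * (g p - g y) \<le> (y - p) \<bullet> (p - z)"
    by (simp add: c_def d_def right_diff_distrib)
  also have "\<dots> = - (\<mu> * ((1 / \<mu>) *\<^sub>R (z - p) \<bullet> (y - p)))"
    using \<open>\<mu> > 0\<close> by (simp add: inner_commute[of "y - p"] flip: inner_minus_left)
  finally have "\<mu> * (g p + (1 / \<mu>) *\<^sub>R (z - p) \<bullet> (y - p)) \<le> \<mu> * g y"
    by (simp add: algebra_simps)
  then show "g y \<ge> g (prox \<mu> g z) + (1 / \<mu>) *\<^sub>R (z - prox \<mu> g z) \<bullet> (y - prox \<mu> g z)"
    using \<open>\<mu> > 0\<close> by (simp add: p_def)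
qed

text \<open>Moving from \<open>x\<close> in the direction \<open>s\<close> itself raises
  \<open>g\<close> by at least the square of \<open>norm s\<close>, and by at most
  \<open>L * norm s\<close>.\<close>

lemma subgradient_norm_le:
  fixes g :: "'a::real_inner \<Rightarrow> real"
  assumes "L-lipschitz_on UNIV g" and "s \<in> subdifferential g x"
  shows "norm s \<le> L"
proof -
  have "s \<bullet> s \<le> g (x + s) - g x"
    using assms(2) by (auto simp: subdifferential_def dest: spec[of _ "x + s"])
  also have "\<dots> \<le> L * norm s"
    using lipschitz_onD[OF assms(1), of "x + s" x] by (simp add: dist_norm)
  finally have "norm s * norm s \<le> L * norm s"
    by (simp add: dot_square_norm power2_eq_square)
  then show ?thesis
    using lipschitz_on_nonneg[OF assms(1)] by (cases "s = 0") auto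
qed

text \<open>For each fixed \<open>y\<close> the subgradient inequality is, by continuity of
  \<open>g\<close>, a closed condition on the point and the subgradient jointly.\<close>

lemma subdifferential_closed_graph:
  fixes g :: "'a::real_inner \<Rightarrow> real"
  assumes "continuous_on UNIV g" and X: "X \<longlonglongrightarrow> x" and S: "S \<longlonglongrightarrow> s"
    and sub: "\<And>k. S k \<in> subdifferential g (X k)"
  shows "s \<in> subdifferential g x"
proof -
  have "g x + s \<bullet> (y - x) \<le> g y" for y
  proof (rule LIMSEQ_le_const2)
    have "(\<lambda>k. g (X k)) \<longlonglongrightarrow> g x"
      using continuous_on_tendsto_compose[OF assms(1) X] by simp
    then show "(\<lambda>k. g (X k) + S k \<bullet> (y - X k)) \<longlonglongrightarrow> g x + s \<bullet> (y - x)"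
      by (intro tendsto_intros X S)
    show "\<exists>N. \<forall>n\<ge>N. g (X n) + S n \<bullet> (y - X n) \<le> g y"
      using sub by (auto simp: subdifferential_def)
  qed
  then show ?thesis
    by (simp add: subdifferential_def)
qed

lemma convex_on_norm1: "convex_on UNIV (norm1 :: real^'q^'n \<Rightarrow> real)"
proof (intro convex_onI)
  fix t :: real and x y :: "real^'q^'n"
  assume t: "0 < t" "t < 1"
  have "\<bar>((1 - t) *\<^sub>R x + t *\<^sub>R y) $ i $ j\<bar> \<le> (1 - t) * \<bar>x $ i $ j\<bar> + t * \<bar>y $ i $ j\<bar>" for i j
    using t abs_triangle_ineq[of "(1 - t) * x $ i $ j" "t * y $ i $ j"] by (simp add: abs_mult)
  then have "norm1 ((1 - t) *\<^sub>R x + t *\<^sub>R y)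
      \<le> (\<Sum>i\<in>UNIV. \<Sum>j\<in>UNIV. (1 - t) * \<bar>x $ i $ j\<bar> + t * \<bar>y $ i $ j\<bar>)"
    unfolding norm1_def by (intro sum_mono)
  then show "norm1 ((1 - t) *\<^sub>R x + t *\<^sub>R y) \<le> (1 - t) * norm1 x + t * norm1 y"
    by (simp add: norm1_def sum.distrib sum_distrib_left)
qed simp

section \<open>The inexact proximal step\<close>

text \<open>The multiplier disappears here: \<open>B_map\<close> has normal values, which tangent
  vectors do not see. What remains is first-order optimality up to an error proportional to
  \<open>w\<close>, and the stopping criterion controls \<open>w\<close> by
  \<open>\<eta>\<close>.\<close>

lemma approx_solves_subgradient:
  fixes f g :: "real^'q^'n \<Rightarrow> real"
  assumes x: "x \<in> Fv v"
    and basis: "orthonormal_basis (normal_space_at v x) (normal_dim TYPE(real^'q^'n)) (V x)"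
    and nonneg: "\<And>w. g w \<ge> 0" and convex: "convex_on UNIV g" and lip: "L-lipschitz_on UNIV g"
    and "\<mu> > 0" and \<eta>: "approx_solves v f g V \<mu> L x \<eta>"
  obtains w s where "norm w \<le> 2 * norm \<eta>" and "s \<in> subdifferential g (x + w)"
    and "\<And>\<xi>. \<xi> \<in> tangent_space v x \<Longrightarrow> (gradient f x + s) \<bullet> \<xi> = - (1 / \<mu>) * (w \<bullet> \<xi>)"
proof -
  let ?T = "tangent_space v x" and ?d = "normal_dim TYPE(real^'q^'n)"
  have T: "subspace ?T"
    using x by (simp add: Fv_iff subspace_tangent_space)
  obtain \<Lambda> where \<Lambda>: "L2_set (Psi v f g V \<mu> x \<Lambda>) {..<?d}
      \<le> sqrt (4 * \<mu>\<^sup>2 * L\<^sup>2 + (norm (w_hat v f g V \<mu> x \<Lambda>))\<^sup>2 / 2) - 2 * \<mu> * L"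
    and \<eta>_eq: "\<eta> = w_hat v f g V \<mu> x \<Lambda>"
    using \<eta> unfolding approx_solves_def by blast
  define w where "w = w_step v f g V \<mu> x \<Lambda>"
  define u where "u = x - \<mu> *\<^sub>R (riem_grad v f x - B_map V x \<Lambda>)"
  have \<eta>_w: "\<eta> \<in> ?T" "w - \<eta> \<in> normal_space_at v x"
    using orth_proj_decomp[OF T, of w]
    by (auto simp: \<eta>_eq w_hat_def w_def normal_space_at_def)
  have normal: "n \<bullet> \<xi> = 0" if "n \<in> normal_space_at v x" "\<xi> \<in> ?T" for n \<xi>
    using that by (auto simp: normal_space_at_def orthogonal_comp_def orthogonal_def inner_commute)
  have V_normal: "V x i \<in> normal_space_at v x" if "i < ?d" for i
  proof -
    have "V x i \<in> span (V x ` {..<?d})"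
      using that by (intro span_base) simp
    then show ?thesis
      using basis by (simp add: orthonormal_basis_def)
  qed
  \<comment> \<open>As \<open>\<eta>\<close> is tangent, the entries of \<open>Psi\<close> are the
    coordinates of the normal component \<open>w - \<eta>\<close>.\<close>
  have "L2_set (Psi v f g V \<mu> x \<Lambda>) {..<?d} = L2_set (\<lambda>i. V x i \<bullet> (w - \<eta>)) {..<?d}"
    using normal[OF V_normal \<eta>_w(1)]
    by (intro L2_set_cong) (simp_all add: Psi_def B_adj_def w_def inner_diff_right inner_commute
        flip: inner_eq_trace)
  also have "\<dots> = norm (w - \<eta>)"
    by (rule L2_set_orthonormal_basis[OF basis \<eta>_w(2)])
  finally have "norm (w - \<eta>) \<le> sqrt ((2 * \<mu> * L)\<^sup>2 + (norm \<eta>)\<^sup>2 / 2) - 2 * \<mu> * L"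
    using \<Lambda> by (simp add: \<eta>_eq power_mult_distrib)
  \<comment> \<open>Subadditivity of the square root; the root of the first square is
    \<open>2 * \<mu> * L\<close>, which is nonnegative and cancels.\<close>
  also have "\<dots> \<le> sqrt ((norm \<eta>)\<^sup>2 / 2)"
    using sqrt_add_le_add_sqrt[of "(2 * \<mu> * L)\<^sup>2" "(norm \<eta>)\<^sup>2 / 2"]
      lipschitz_on_nonneg[OF lip] \<open>\<mu> > 0\<close> by simp
  also have "\<dots> \<le> norm \<eta>"
    by (rule real_le_lsqrt) auto
  finally have "norm w \<le> 2 * norm \<eta>"
    using norm_triangle_sub[of w \<eta>] by simp
  moreover
  \<comment> \<open>\<open>x + w\<close> is the proximal point of \<open>u\<close>, and
    \<open>s\<close> is the subgradient supplied by its optimality condition.\<close>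
  define s where "s = (1 / \<mu>) *\<^sub>R (u - (x + w))"
  have "s \<in> subdifferential g (x + w)"
    using prox_subgradient[OF lipschitz_on_continuous_on[OF lip] nonneg convex \<open>\<mu> > 0\<close>, of u]
    by (simp add: s_def w_def w_step_def u_def)
  moreover have "(gradient f x + s) \<bullet> \<xi> = - (1 / \<mu>) * (w \<bullet> \<xi>)" if \<xi>: "\<xi> \<in> ?T" for \<xi>
  proof -
    have "s = - riem_grad v f x + B_map V x \<Lambda> - (1 / \<mu>) *\<^sub>R w"
      using \<open>\<mu> > 0\<close> by (simp add: s_def u_def algebra_simps)
    moreover have "(gradient f x - riem_grad v f x) \<bullet> \<xi> = 0"
      using orth_proj_decomp(2)[OF T] \<xi> by (intro normal) (auto simp: riem_grad_def normal_space_at_def)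
    moreover have "B_map V x \<Lambda> \<bullet> \<xi> = 0"
      using normal[OF V_normal \<xi>] by (simp add: B_map_def inner_sum_left)
    ultimately show ?thesis
      by (simp add: inner_add_left inner_diff_left)
  qed
  ultimately show thesis
    by (rule that)
qed

section \<open>The decrease of the objective\<close>

text \<open>The loop keeps \<open>\<alpha> = \<nu> ^ i\<close> and \<open>i \<le> N_max\<close>, and
  \<open>N_max - i\<close> decreases. If it ends with \<open>i \<noteq> N_max\<close>, the counter
  is below its bound, so the decrease condition must have stopped it.\<close>

lemma line_search_decrease:
  assumes "line_search F R \<sigma> \<nu> N_max z \<eta> = (\<alpha>, i)" "i \<noteq> N_max"
  shows "\<alpha> = \<nu> ^ i" "i < N_max" "F (R z (\<alpha> *\<^sub>R \<eta>)) \<le> F z - \<sigma> * \<alpha> * (norm \<eta>)\<^sup>2"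
proof -
  let ?b = "\<lambda>(\<alpha>, i). F (R z (\<alpha> *\<^sub>R \<eta>)) > F z - \<sigma> * \<alpha> * (norm \<eta>)\<^sup>2 \<and> i < N_max"
  let ?Q = "\<lambda>(\<alpha>, i). \<alpha> = \<nu> ^ i \<and> i \<le> N_max \<and> \<not> ?b (\<alpha>, i)"
  have "?Q (line_search F R \<sigma> \<nu> N_max z \<eta>)"
    unfolding line_search_def
    by (rule while_rule[where P = "\<lambda>(\<alpha>, i). \<alpha> = \<nu> ^ i \<and> i \<le> N_max"
          and r = "Wellfounded.measure (\<lambda>(\<alpha>, i). N_max - i)"]) auto
  then show "\<alpha> = \<nu> ^ i" "i < N_max" "F (R z (\<alpha> *\<^sub>R \<eta>)) \<le> F z - \<sigma> * \<alpha> * (norm \<eta>)\<^sup>2"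
    using assms by auto
qed

text \<open>A safeguard sets the next \<open>z\<close> to the better of the line search point and
  \<open>x k\<close>, so the decrease achieved by the line search is inherited in both
  cases.\<close>

lemma AManPG_decrease:
  assumes run: "AManPG v f g V D R L \<mu> \<sigma> \<nu> N N_max x\<^sub>0 z" and retr: "manifold_retraction v D R"
    and x0: "x\<^sub>0 \<in> Fv v" and "\<nu> \<in> {0<..<1}" "\<sigma> > 0" "N > 0"
  obtains \<eta> where "\<And>i. z (i * N) \<in> Fv v" "\<And>i. approx_solves v f g V \<mu> L (z (i * N)) (\<eta> i)"
    "\<And>i. f (z (Suc i * N)) + g (z (Suc i * N))
      \<le> f (z (i * N)) + g (z (i * N)) - \<sigma> * \<nu> ^ N_max * (norm (\<eta> i))\<^sup>2"
proof -
  define F where "F = (\<lambda>x. f x + g x)"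
  have R: "R x \<xi> \<in> Fv v" if "(x, \<xi>) \<in> D" for x \<xi>
    using retr that by (auto simp: manifold_retraction_def)
  obtain x y t x' y' t' \<eta> \<eta>y where init: "x 0 = x\<^sub>0" "z 0 = x\<^sub>0"
    and safe: "\<And>k. if N dvd k then approx_solves v f g V \<mu> L (z k) (\<eta> k) \<and>
            (let (\<alpha>, i) = line_search F R \<sigma> \<nu> N_max (z k) (\<eta> k) in
               (\<forall>j\<le>i. (z k, \<nu> ^ j *\<^sub>R \<eta> k) \<in> D) \<and> i \<noteq> N_max \<and>
               (if F (R (z k) (\<alpha> *\<^sub>R \<eta> k)) < F (x k)
                then x' k = R (z k) (\<alpha> *\<^sub>R \<eta> k) \<and> y' k = R (z k) (\<alpha> *\<^sub>R \<eta> k) \<and> t' k = (1::real)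
                else x' k = x k \<and> y' k = y k \<and> t' k = t k)) \<and>
            z (k + N) = x' k
          else x' k = x k \<and> y' k = y k \<and> t' k = t k"
    and step: "\<And>k. (y' k, \<eta>y k) \<in> D" "\<And>k. x (Suc k) = R (y' k) (\<eta>y k)"
    using run unfolding AManPG_def Let_def F_def by blast
  \<comment> \<open>Every iterate after the first is a value of the retraction at a point of its
    domain.\<close>
  have x: "x k \<in> Fv v" for k
    by (cases k) (use init x0 step R in auto)
  have *: "approx_solves v f g V \<mu> L (z k) (\<eta> k) \<and> z (k + N) \<in> Fv v \<and>
      F (z (k + N)) \<le> F (z k) - \<sigma> * \<nu> ^ N_max * (norm (\<eta> k))\<^sup>2" if "N dvd k" for k
  proof -
    obtain \<alpha> i where ls: "line_search F R \<sigma> \<nu> N_max (z k) (\<eta> k) = (\<alpha>, i)"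
      by fastforce
    define p where "p = R (z k) (\<alpha> *\<^sub>R \<eta> k)"
    have s: "approx_solves v f g V \<mu> L (z k) (\<eta> k)" "(z k, \<nu> ^ i *\<^sub>R \<eta> k) \<in> D" "i \<noteq> N_max"
      "z (k + N) = (if F p < F (x k) then p else x k)"
      using safe[of k] that by (auto simp: ls p_def)
    note dec = line_search_decrease[OF ls s(3)]
    have "p \<in> Fv v"
      unfolding p_def using R s(2) dec(1) by simp
    moreover have "F p \<le> F (z k) - \<sigma> * \<nu> ^ N_max * (norm (\<eta> k))\<^sup>2"
    proof -
      \<comment> \<open>The bounded number of reductions gives a lower bound on the step size that
        is uniform over all safeguards.\<close>
      have "\<nu> ^ N_max \<le> \<alpha>"
        using dec(1,2) assms(4) by (auto intro: power_decreasing)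
      then have "\<sigma> * \<nu> ^ N_max * (norm (\<eta> k))\<^sup>2 \<le> \<sigma> * \<alpha> * (norm (\<eta> k))\<^sup>2"
        using \<open>\<sigma> > 0\<close> by (intro mult_right_mono mult_left_mono) auto
      then show ?thesis
        using dec(3) by (simp add: p_def)
    qed
    ultimately show ?thesis
      using s(1,4) x by auto
  qed
  have "z (i * N) \<in> Fv v" for i
    using init(2) x0 *[of "(i - 1) * N"] by (cases i) (auto simp: add.commute)
  moreover have "approx_solves v f g V \<mu> L (z (i * N)) (\<eta> (i * N))" for i
    using *[of "i * N"] by simp
  moreover have "F (z (Suc i * N)) \<le> F (z (i * N)) - \<sigma> * \<nu> ^ N_max * (norm (\<eta> (i * N)))\<^sup>2" for i
    using *[of "i * N"] by (simp add: add.commute)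
  ultimately show thesis
    using that[of "\<lambda>i. \<eta> (i * N)"] unfolding F_def by blast
qed

text \<open>A convergent subsequence bounds the decreasing sequence \<open>a\<close> from below, so
  all of \<open>a\<close> converges and its successive differences tend to 0. They dominate the
  squared norms of \<open>\<eta>\<close> up to the factor \<open>c\<close>.\<close>

lemma sufficient_decrease_imp_null:
  fixes a :: "nat \<Rightarrow> real" and \<eta> :: "nat \<Rightarrow> 'a::real_normed_vector"
  assumes dec: "\<And>i. a (Suc i) \<le> a i - c * (norm (\<eta> i))\<^sup>2" and "c > 0"
    and r: "strict_mono r" "(\<lambda>k. a (r k)) \<longlonglongrightarrow> l"
  shows "\<eta> \<longlonglongrightarrow> 0"
proof -
  have "a (Suc i) \<le> a i" for i
  proof -
    have "0 \<le> c * (norm (\<eta> i))\<^sup>2"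
      using \<open>c > 0\<close> by simp
    with dec[of i] show ?thesis
      by linarith
  qed
  then have a: "decseq a"
    by (simp add: decseq_Suc_iff)
  have "decseq (\<lambda>k. a (r k))"
    using a r(1) by (auto simp: decseq_def strict_mono_less_eq)
  \<comment> \<open>\<open>r i \<ge> i\<close> for a strictly increasing \<open>r\<close>, so
    \<open>a i \<ge> a (r i) \<ge> l\<close>.\<close>
  then have "l \<le> a i" for i
    using decseq_ge[OF _ r(2), of i] decseqD[OF a seq_suble[OF r(1), of i]] by simp
  then obtain m where m: "a \<longlonglongrightarrow> m"
    using decseq_convergent[OF a] by blast
  have "(\<lambda>i. (norm (\<eta> i))\<^sup>2) \<longlonglongrightarrow> 0"
  proof (rule tendsto_sandwich[where f = "\<lambda>_. 0" and h = "\<lambda>i. (a i - a (Suc i)) / c"])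
    show "\<forall>\<^sub>F i in sequentially. (norm (\<eta> i))\<^sup>2 \<le> (a i - a (Suc i)) / c"
      using dec \<open>c > 0\<close> by (intro always_eventually) (simp add: field_simps add.commute)
    have "(\<lambda>i. (a i - a (Suc i)) / c) \<longlonglongrightarrow> (m - m) / c"
      using \<open>c > 0\<close> by (intro tendsto_intros m LIMSEQ_Suc) auto
    then show "(\<lambda>i. (a i - a (Suc i)) / c) \<longlonglongrightarrow> 0"
      by simp
  qed auto
  then have "(\<lambda>i. sqrt ((norm (\<eta> i))\<^sup>2)) \<longlonglongrightarrow> sqrt 0"
    by (rule tendsto_real_sqrt)
  then show ?thesis
    by (simp add: tendsto_norm_zero_iff)
qed

section \<open>Passage to the limit at an accumulation point\<close>

theorem theorem4p1:
  fixes v :: "real^'n"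
    and f g :: "real^'q^'n \<Rightarrow> real"
    and V :: "real^'q^'n \<Rightarrow> nat \<Rightarrow> real^'q^'n"
    and D :: "((real^'q^'n) \<times> (real^'q^'n)) set"
    and R :: "real^'q^'n \<Rightarrow> real^'q^'n \<Rightarrow> real^'q^'n"
    and L\<^sub>f L\<^sub>g lam \<mu> \<sigma> \<nu> :: real
    and N N_max :: nat
    and x\<^sub>0 z_star :: "real^'q^'n"
    and z :: "nat \<Rightarrow> real^'q^'n"
  assumes "\<forall>i. v $ i > 0"
    and "smooth_on UNIV f"
    and "lam > 0" and "g = (\<lambda>x. lam * norm1 x)"
    and "L\<^sub>f-lipschitz_on (Fv v) (gradient f)"
    and "L\<^sub>g-lipschitz_on UNIV g"
    and "manifold_retraction v D R"
    and "\<forall>x \<in> Fv v. orthonormal_basis (normal_space_at v x) (normal_dim TYPE(real^'q^'n)) (V x)"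
    and "\<mu> > 0" and "\<sigma> \<in> {0<..1 / (8 * \<mu>)}" and "\<nu> \<in> {0<..<1}"
    and "N > 0" and "N_max > 0"
    and "x\<^sub>0 \<in> Fv v"
    and "AManPG v f g V D R L\<^sub>g \<mu> \<sigma> \<nu> N N_max x\<^sub>0 z"
    and "accumulation_point (\<lambda>i. z (i * N)) z_star"
  shows "stationary v f g z_star"
proof -
  have "v \<noteq> 0"
    using assms(1) by (metis less_irrefl zero_index)
  have g_cont: "continuous_on UNIV g"
    using lipschitz_on_continuous_on[OF assms(6)] .
  have g_nonneg: "g x \<ge> 0" for x
    using \<open>lam > 0\<close> by (simp add: assms(4) norm1_def sum_nonneg)
  have g_convex: "convex_on UNIV g"
    unfolding assms(4) using \<open>lam > 0\<close> by (intro convex_on_cmul convex_on_norm1) simp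
  have "Ck_on (Suc 0) UNIV f"
    using assms(2) unfolding smooth_on_def by blast
  then have f_cont: "continuous_on UNIV f"
    by (auto intro!: continuous_at_imp_continuous_on differentiable_imp_continuous_within)
  obtain \<eta> where z: "\<And>i. z (i * N) \<in> Fv v"
    and solves: "\<And>i. approx_solves v f g V \<mu> L\<^sub>g (z (i * N)) (\<eta> i)"
    and dec: "\<And>i. f (z (Suc i * N)) + g (z (Suc i * N))
      \<le> f (z (i * N)) + g (z (i * N)) - \<sigma> * \<nu> ^ N_max * (norm (\<eta> i))\<^sup>2"
    using AManPG_decrease[OF assms(15,7,14,11) _ assms(12)] assms(10) by auto
  obtain r where r: "strict_mono r" and lim: "(\<lambda>k. z (r k * N)) \<longlonglongrightarrow> z_star"
    using assms(16) by (auto simp: accumulation_point_def o_def)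
  \<comment> \<open>Continuity of \<open>f\<close> and \<open>g\<close> gives convergence of the
    objective along \<open>r\<close>; monotonicity extends the effect to the whole sequence
    \<open>\<eta>\<close>.\<close>
  have "\<eta> \<longlonglongrightarrow> 0"
  proof (rule sufficient_decrease_imp_null[where
        a = "\<lambda>i. f (z (i * N)) + g (z (i * N))" and \<eta> = \<eta>, OF dec _ r])
    show "\<sigma> * \<nu> ^ N_max > 0"
      using assms(10,11) by simp
    show "(\<lambda>k. f (z (r k * N)) + g (z (r k * N))) \<longlonglongrightarrow> f z_star + g z_star"
      using continuous_on_tendsto_compose[OF f_cont lim] continuous_on_tendsto_compose[OF g_cont lim]
      by (intro tendsto_add) simp_all
  qed
  have "\<exists>w s. norm w \<le> 2 * norm (\<eta> i) \<and> s \<in> subdifferential g (z (i * N) + w) \<and>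
      (\<forall>\<xi> \<in> tangent_space v (z (i * N)).
         (gradient f (z (i * N)) + s) \<bullet> \<xi> = - (1 / \<mu>) * (w \<bullet> \<xi>))" for i
    using approx_solves_subgradient[where V = V, OF z _ g_nonneg g_convex assms(6,9) solves] assms(8) z
    by metis
  then obtain w s where w: "\<And>i. norm (w i) \<le> 2 * norm (\<eta> i)"
    and s: "\<And>i. s i \<in> subdifferential g (z (i * N) + w i)"
    and ortho: "\<And>i \<xi>. \<xi> \<in> tangent_space v (z (i * N)) \<Longrightarrow>
      (gradient f (z (i * N)) + s i) \<bullet> \<xi> = - (1 / \<mu>) * (w i \<bullet> \<xi>)"
    by metis
  have "w \<longlonglongrightarrow> 0"
  proof (rule tendsto_0_le[where K = 2])
    show "\<eta> \<longlonglongrightarrow> 0" by fact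
  qed (use w in \<open>simp add: mult.commute\<close>)
  have "s (r k) \<in> cball 0 L\<^sub>g" for k
    using subgradient_norm_le[OF assms(6) s] by simp
  then obtain s_star r' where r': "strict_mono r'" and s_lim: "((\<lambda>k. s (r k)) \<circ> r') \<longlonglongrightarrow> s_star"
    using compact_cball[of 0 L\<^sub>g, unfolded compact_def, THEN spec, of "\<lambda>k. s (r k)"] by blast
  define \<rho> where "\<rho> = r \<circ> r'"
  have \<rho>: "strict_mono \<rho>"
    using r r' by (simp add: \<rho>_def strict_mono_o)
  have z_lim: "(\<lambda>k. z (\<rho> k * N)) \<longlonglongrightarrow> z_star"
    using LIMSEQ_subseq_LIMSEQ[OF lim r'] by (simp add: \<rho>_def o_def)
  have w_lim: "(\<lambda>k. w (\<rho> k)) \<longlonglongrightarrow> 0"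
    using LIMSEQ_subseq_LIMSEQ[OF \<open>w \<longlonglongrightarrow> 0\<close> \<rho>] by (simp add: o_def)
  have s_lim: "(\<lambda>k. s (\<rho> k)) \<longlonglongrightarrow> s_star"
    using s_lim by (simp add: \<rho>_def o_def)
  have star: "z_star \<in> Fv v"
    using closed_sequentially[OF closed_Fv z z_lim] .
  have grad_lim: "(\<lambda>k. gradient f (z (\<rho> k * N))) \<longlonglongrightarrow> gradient f z_star"
    using continuous_on_tendsto_compose[OF lipschitz_on_continuous_on[OF assms(5)] z_lim star] z by simp
  have "(\<lambda>k. z (\<rho> k * N) + w (\<rho> k)) \<longlonglongrightarrow> z_star"
    using tendsto_add[OF z_lim w_lim] by simp
  then have "s_star \<in> subdifferential g z_star"
    by (rule subdifferential_closed_graph[OF g_cont _ s_lim s])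
  moreover have "(gradient f z_star + s_star) \<bullet> \<xi> = 0" if \<xi>: "\<xi> \<in> tangent_space v z_star" for \<xi>
  proof -
    \<comment> \<open>\<open>\<xi>\<close> need not be tangent at the iterates, so
      \<open>ortho\<close> is applied to tangent vectors \<open>Y k\<close> approaching it. Both
      sides of \<open>ortho\<close> then converge, the right one to 0 because \<open>w\<close>
      does.\<close>
    obtain Y where Y: "\<And>k. Y k \<in> tangent_space v (z (\<rho> k * N))" "Y \<longlonglongrightarrow> \<xi>"
      using tangent_space_lower_semicontinuous[OF z z_lim \<open>v \<noteq> 0\<close> \<xi>] by blast
    have "(\<lambda>k. (gradient f (z (\<rho> k * N)) + s (\<rho> k)) \<bullet> Y k) \<longlonglongrightarrow> (gradient f z_star + s_star) \<bullet> \<xi>"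
      by (intro tendsto_intros grad_lim s_lim Y(2))
    moreover have "(\<lambda>k. - (1 / \<mu>) * (w (\<rho> k) \<bullet> Y k)) \<longlonglongrightarrow> - (1 / \<mu>) * (0 \<bullet> \<xi>)"
      by (intro tendsto_intros w_lim Y(2))
    ultimately show ?thesis
      using LIMSEQ_unique by (fastforce simp: ortho[OF Y(1)])
  qed
  \<comment> \<open>A vector orthogonal to the tangent space has projection 0.\<close>
  then have "orth_proj (tangent_space v z_star) (gradient f z_star + s_star) = 0"
    using star
    by (intro orth_proj_unique)
       (auto simp: Fv_iff subspace_tangent_space subspace_0 orthogonal_comp_def orthogonal_def inner_commute)
  ultimately show ?thesis
    unfolding stationary_def by force
qed

end
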